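(* Let $\mathcal{H}$ be a real Hilbert space, let $T\colon\mathcal{H}\to\mathcal{H}$ be nonexpansive with infimal displacement vector $v$, let $\lambda_k\in[0,1)$ for $k=1,2,\dots$ with $\lambda_i>0$ for at least one $i$, let $k_0=\min\{i\in\mathbb{N}:\lambda_i>0\}$, and let $\{x^k\}_{k\in\mathbb{N}}$ be the iterates of the Krasnosel'skii--Mann iteration \[ x^{k+1}=\lambda_{k+1}x^k+(1-\lambda_{k+1})Tx^k,\qquad k=0,1,\dots, \] starting from $x^0\in\mathcal{H}$. Write $S_k=\sum_{j=0}^k\lambda_{j+1}(1-\lambda_{j+1})$. For any $\varepsilon>0$ and any $x_\varepsilon\in\mathcal{H}$ such that $\|x_\varepsilon-Tx_\varepsilon-v\|\le\min\left\{\frac{\varepsilon^2}{2\|v\|+1},\,1,\,\varepsilon\right\}$, \[ \left(\sum_{i=0}^k\frac{\lambda_{i+1}(1-\lambda_{i+1})}{S_k}\|x^i-Tx^i-v\|\right)^2\le\left(\frac{1}{\sqrt{S_k}}\|x^0-x_\varepsilon\|+\varepsilon\right)^2 \] and \[ \left(\|x^k-Tx^k\|-\|v\|\right)^2\le\left(\frac{1}{\sqrt{S_k}}\|x^0-x_\varepsilon\|+\varepsilon\right)^2 \] for all $k\ge k_0$. If furthermore $v\in\mathcal{R}(I-T)$, then there exists $x_\star\in\mathcal{H}$ such that $x_\star-Tx_\star=v$, \[ \left(\sum_{i=0}^k\frac{\lambda_{i+1}(1-\lambda_{i+1})}{S_k}\|x^i-Tx^i-v\|\right)^2\le\frac{1}{S_k}\|x^0-x_\star\|^2,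 \] and \[ \left(\|x^k-Tx^k\|-\|v\|\right)^2\le\frac{1}{S_k}\|x^0-x_\star\|^2 \] for all $k\ge k_0$.
   Context: $T\colon\mathcal{H}\to\mathcal{H}$ is nonexpansive if $\|Tx-Ty\|\le\|x-y\|$ for all $x,y\in\mathcal{H}$. $I$ is the identity operator and $\mathcal{R}(I-T)=\{x-Tx: x\in\mathcal{H}\}$. For nonexpansive $T$ the closure $\overline{\mathcal{R}(I-T)}$ is nonempty, closed and convex, and the infimal displacement vector of $T$ is its unique minimum-norm element $v=\Pi_{\overline{\mathcal{R}(I-T)}}(0)$. *)

theory Defs
  imports "HOL-Analysis.Analysis"
begin

definition nonexpansive :: "('a::real_normed_vector \<Rightarrow> 'a) \<Rightarrow> bool"
  where "nonexpansive T \<longleftrightarrow> (\<forall>x y. norm (T x - T y) \<le> norm (x - y))"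

(* The projection of 0 onto the closure of the range of I - T. The library's closest_point
   is restricted to Heine-Borel (hence finite-dimensional) spaces. The description is
   meaningful for nonexpansive T on a Hilbert space, where the closure is nonempty, closed
   and convex and so has exactly one element of minimum norm. *)
definition infimal_displacement_vector :: "('a::real_inner \<Rightarrow> 'a) \<Rightarrow> 'a"
  where "infimal_displacement_vector T =
    (THE v. v \<in> closure (range (\<lambda>x. x - T x)) \<and>
            (\<forall>w\<in>closure (range (\<lambda>x. x - T x)). norm v \<le> norm w))"

end

theory Submission
  imports Defs
begin

text \<open>Throughout, \<open>A = I - T\<close>, and \<open>v\<close> is the infimal displacement vector.

  The only property of \<open>v\<close> that matters is the variational inequality
  \<open>\<parallel>v\<parallel>\<^sup>2 \<le> \<langle>v, A u\<rangle>\<close> for all \<open>u\<close>. It yields \<open>\<parallel>v\<parallel> \<le> \<parallel>A u\<parallel>\<close>, and it turns near-minimality of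
  the norm into closeness to \<open>v\<close>: \<open>\<parallel>A u - v\<parallel>\<^sup>2 \<le> \<parallel>A u\<parallel>\<^sup>2 - \<parallel>v\<parallel>\<^sup>2\<close>. Instead of proving the closure
  of the range convex and projecting, one can construct \<open>v\<close> as the limit of \<open>A z\<^sub>s\<close> for
  \<open>s \<rightarrow> \<infinity>\<close>, where \<open>z\<^sub>s + s A z\<^sub>s = 0\<close> (a contraction problem); monotonicity of \<open>A\<close> makes
  these vectors a Cauchy sequence, and gives the variational inequality in the limit
  (\<open>infimal_displacement_variational\<close>).

  For the rate, run the same iteration from \<open>x\<^sub>\<epsilon>\<close>, obtaining \<open>y\<^sup>k\<close> next to \<open>x\<^sup>k\<close>. Nonexpansiveness
  decreases \<open>\<parallel>x\<^sup>k - y\<^sup>k\<parallel>\<^sup>2\<close> by at least \<open>\<lambda>(1 - \<lambda>) \<parallel>A x\<^sup>k - A y\<^sup>k\<parallel>\<^sup>2\<close> in each step, so these amounts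
  add up to at most \<open>\<parallel>x\<^sup>0 - x\<^sub>\<epsilon>\<parallel>\<^sup>2\<close> (\<open>krasnoselskii_mann_pair_sum\<close>). Along the iteration \<open>\<parallel>A y\<^sup>k\<parallel>\<close>
  never grows, so every \<open>A y\<^sup>k\<close> stays as close to \<open>v\<close> in the above sense as \<open>A x\<^sub>\<epsilon>\<close> is; hence the
  error caused by \<open>x\<^sub>\<epsilon>\<close> does not accumulate. The Cauchy--Schwarz inequality turns the sum of squares
  into the averaged bound. Because \<open>\<parallel>A x\<^sup>k\<parallel>\<close> does not grow either, \<open>\<parallel>A x\<^sup>k\<parallel> - \<parallel>v\<parallel>\<close> lies below every
  earlier \<open>\<parallel>A x\<^sup>i - v\<parallel>\<close>, hence below their average. If \<open>A x\<^sub>\<star> = v\<close>, the same argument applies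
  with error \<open>0\<close>.\<close>

section \<open>The infimal displacement vector\<close>

text \<open>By the Cauchy--Schwarz inequality,
  \<open>\<langle>(x - T x) - (y - T y), x - y\<rangle> = \<parallel>x - y\<parallel>\<^sup>2 - \<langle>T x - T y, x - y\<rangle> \<ge> 0\<close>.\<close>

lemma nonexpansive_displacement_monotone:
  fixes T :: "'a::real_inner \<Rightarrow> 'a"
  assumes "nonexpansive T"
  shows "0 \<le> ((x - T x) - (y - T y)) \<bullet> (x - y)"
proof -
  have "(T x - T y) \<bullet> (x - y) \<le> norm (T x - T y) * norm (x - y)"
    by (rule norm_cauchy_schwarz)
  also have "\<dots> \<le> norm (x - y) * norm (x - y)"
    using assms by (intro mult_right_mono) (auto simp: nonexpansive_def)
  also have "\<dots> = (x - y) \<bullet> (x - y)"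
    by (simp add: dot_square_norm power2_eq_square)
  finally show ?thesis
    by (simp add: algebra_simps inner_simps)
qed

lemma nonexpansive_resolvent_exists:
  fixes T :: "'a::{real_normed_vector, complete_space} \<Rightarrow> 'a"
  assumes T: "nonexpansive T" and s: "0 < s"
  shows "\<exists>z. z + s *\<^sub>R (z - T z) = 0"
proof -
  define c where "c = s / (1 + s)"
  have c: "0 \<le> c" "c < 1" using s by (auto simp: c_def)
  have "\<exists>!z. c *\<^sub>R T z = z"
  proof (rule banach_fix_type[OF c], intro allI)
    show "dist (c *\<^sub>R T x) (c *\<^sub>R T y) \<le> c * dist x y" for x y
      using T c by (auto simp: dist_norm nonexpansive_def mult_left_mono
          simp flip: scaleR_diff_right)
  qed
  then obtain z where z: "z = c *\<^sub>R T z" by metis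
  have "(1 + s) *\<^sub>R z = s *\<^sub>R T z"
    using s by (subst z) (simp add: c_def)
  then show ?thesis
    by (intro exI[of _ z]) (simp add: algebra_simps)
qed

text \<open>The squared norms form a bounded decreasing sequence, and their differences control the
  distances.\<close>

lemma Cauchy_if_dist_le_norm_decrease:
  fixes a :: "nat \<Rightarrow> 'a::real_normed_vector"
  assumes le: "\<And>m n. n \<le> m \<Longrightarrow> (norm (a m - a n))\<^sup>2 \<le> (norm (a n))\<^sup>2 - (norm (a m))\<^sup>2"
  shows "Cauchy a"
proof -
  have anti: "(norm (a m))\<^sup>2 \<le> (norm (a n))\<^sup>2" if "n \<le> m" for m n
    using le[OF that] zero_le_power2[of "norm (a m - a n)"] by linarith
  then have "decseq (\<lambda>n. (norm (a n))\<^sup>2)" by (simp add: decseq_def)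
  then obtain l where "(\<lambda>n. (norm (a n))\<^sup>2) \<longlonglongrightarrow> l"
    using decseq_convergent[of "\<lambda>n. (norm (a n))\<^sup>2" 0] by auto
  then have C: "Cauchy (\<lambda>n. (norm (a n))\<^sup>2)" by (rule LIMSEQ_imp_Cauchy)
  show ?thesis
  proof (rule CauchyI')
    fix e :: real assume "0 < e"
    then obtain M where M: "\<And>m n. m \<ge> M \<Longrightarrow> n \<ge> M \<Longrightarrow> norm ((norm (a m))\<^sup>2 - (norm (a n))\<^sup>2) < e\<^sup>2"
      using CauchyD[OF C, of "e\<^sup>2"] by auto
    have "dist (a m) (a n) < e" if "M \<le> m" "m < n" for m n
    proof -
      have "(norm (a n - a m))\<^sup>2 < e\<^sup>2"
        using le[of m n] M[of m n] that by fastforce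
      then have "norm (a n - a m) < e"
        using \<open>0 < e\<close> by (meson less_le power2_less_imp_less)
      then show ?thesis by (simp add: dist_norm norm_minus_commute)
    qed
    then show "\<exists>M. \<forall>m\<ge>M. \<forall>n>m. dist (a m) (a n) < e" by blast
  qed
qed

text \<open>This is monotonicity tested at the two resolvent points \<open>- s a\<close> and \<open>- r b\<close>, since
  \<open>2 (s a - r b) = (s + r) (a - b) + (s - r) (a + b)\<close>.\<close>

lemma resolvent_norm_decrease:
  fixes a b :: "'a::real_inner"
  assumes mono: "(a - b) \<bullet> (s *\<^sub>R a - r *\<^sub>R b) \<le> 0" and rs: "0 < r" "r \<le> s"
  shows "(norm (a - b))\<^sup>2 \<le> (norm b)\<^sup>2 - (norm a)\<^sup>2"
proof -
  have "2 * ((a - b) \<bullet> (s *\<^sub>R a - r *\<^sub>R b))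
      = (s + r) * (norm (a - b))\<^sup>2 - (s - r) * ((norm b)\<^sup>2 - (norm a)\<^sup>2)"
    by (simp add: power2_norm_eq_inner inner_simps inner_commute algebra_simps)
  with mono have *: "(s + r) * (norm (a - b))\<^sup>2 \<le> (s - r) * ((norm b)\<^sup>2 - (norm a)\<^sup>2)"
    by linarith
  show ?thesis
  proof (cases "r = s")
    case True
    then have "(s + r) * (norm (a - b))\<^sup>2 \<le> 0" using * by simp
    then have "a = b" using rs by (simp add: mult_le_0_iff)
    then show ?thesis by simp
  next
    case False
    then have sr: "0 < s - r" using rs by simp
    have "0 \<le> (s - r) * ((norm b)\<^sup>2 - (norm a)\<^sup>2)"
      using * rs by (smt (verit) mult_nonneg_nonneg zero_le_power2)
    then have nn: "0 \<le> (norm b)\<^sup>2 - (norm a)\<^sup>2"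
      using sr by (simp add: zero_le_mult_iff)
    have "(s + r) * (norm (a - b))\<^sup>2 \<le> (s + r) * ((norm b)\<^sup>2 - (norm a)\<^sup>2)"
      using * nn rs by (smt (verit) mult_right_mono)
    then show ?thesis using rs by simp
  qed
qed

text \<open>With \<open>A = I - T\<close> and \<open>z\<^sub>s = - s A z\<^sub>s\<close>, monotonicity at \<open>z\<^sub>s\<close> and \<open>u\<close> reads
  \<open>\<langle>A z\<^sub>s - A u, A z\<^sub>s + u / s\<rangle> \<le> 0\<close>. As \<open>s\<close> grows the term \<open>u / s\<close> disappears, and the limit \<open>v\<close> of
  \<open>A z\<^sub>s\<close> satisfies \<open>\<langle>v - A u, v\<rangle> \<le> 0\<close>.\<close>

lemma displacement_variational_vector_exists:
  fixes T :: "'a::{real_inner, complete_space} \<Rightarrow> 'a"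
  assumes T: "nonexpansive T"
  shows "\<exists>v\<in>closure (range (\<lambda>x. x - T x)). \<forall>u. (norm v)\<^sup>2 \<le> v \<bullet> (u - T u)"
proof -
  obtain z where z: "\<And>n. z n + real (Suc n) *\<^sub>R (z n - T (z n)) = 0"
  proof -
    have "\<forall>n. \<exists>z. z + real (Suc n) *\<^sub>R (z - T z) = 0"
      by (intro allI nonexpansive_resolvent_exists[OF T]) simp
    then show ?thesis using that by metis
  qed
  define a where "a n = z n - T (z n)" for n
  have za: "z n = - (real (Suc n) *\<^sub>R a n)" for n
    using z[of n] unfolding a_def by (metis eq_neg_iff_add_eq_0)
  have mono: "(a n - (u - T u)) \<bullet> (real (Suc n) *\<^sub>R a n + u) \<le> 0" for n u
  proof -
    have "0 \<le> (a n - (u - T u)) \<bullet> (z n - u)"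
      using nonexpansive_displacement_monotone[OF T, of "z n" u] by (simp add: a_def)
    also have "z n - u = - (real (Suc n) *\<^sub>R a n + u)" by (simp add: za)
    finally show ?thesis by (simp only: inner_minus_right)
  qed
  have "Cauchy a"
  proof (rule Cauchy_if_dist_le_norm_decrease)
    fix m n :: nat assume "n \<le> m"
    have "(a m - a n) \<bullet> (real (Suc m) *\<^sub>R a m - real (Suc n) *\<^sub>R a n) \<le> 0"
      using mono[of m "z n"] unfolding a_def[of n, symmetric] by (simp add: za[of n])
    then show "(norm (a m - a n))\<^sup>2 \<le> (norm (a n))\<^sup>2 - (norm (a m))\<^sup>2"
      by (rule resolvent_norm_decrease) (use \<open>n \<le> m\<close> in auto)
  qed
  then obtain v where lim: "a \<longlonglongrightarrow> v"
    using Cauchy_convergent convergent_def by blast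
  have "v \<in> closure (range (\<lambda>x. x - T x))"
    unfolding closure_sequential using lim by (intro exI[of _ a]) (auto simp: a_def)
  moreover have "(norm v)\<^sup>2 \<le> v \<bullet> (u - T u)" for u
  proof -
    have "(a n - (u - T u)) \<bullet> (a n + inverse (real (Suc n)) *\<^sub>R u) \<le> 0" for n
    proof -
      have "(a n - (u - T u)) \<bullet> (a n + inverse (real (Suc n)) *\<^sub>R u)
          = inverse (real (Suc n)) * ((a n - (u - T u)) \<bullet> (real (Suc n) *\<^sub>R a n + u))"
        by (simp flip: inner_scaleR_right add: scaleR_add_right del: of_nat_Suc)
      then show ?thesis using mono[of n u] by (simp add: mult_nonneg_nonpos del: of_nat_Suc)
    qed
    moreover have "(\<lambda>n. (a n - (u - T u)) \<bullet> (a n + inverse (real (Suc n)) *\<^sub>R u))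
        \<longlonglongrightarrow> (v - (u - T u)) \<bullet> (v + 0 *\<^sub>R u)"
      by (intro tendsto_intros lim LIMSEQ_inverse_real_of_nat)
    ultimately have "(v - (u - T u)) \<bullet> (v + 0 *\<^sub>R u) \<le> 0"
      by (intro LIMSEQ_le_const2) auto
    then show ?thesis
      by (simp add: power2_norm_eq_inner inner_simps inner_commute)
  qed
  ultimately show ?thesis by blast
qed

lemma norm_ge_if_variational:
  fixes v w :: "'a::real_inner"
  assumes "(norm v)\<^sup>2 \<le> v \<bullet> w"
  shows "norm v \<le> norm w"
proof -
  have "norm v * norm v \<le> norm v * norm w"
    using assms norm_cauchy_schwarz[of v w] by (simp add: power2_eq_square)
  then show ?thesis by (cases "v = 0") auto
qed

lemma norm_diff_le_if_variational:
  fixes v w :: "'a::real_inner"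
  assumes "(norm v)\<^sup>2 \<le> v \<bullet> w"
  shows "(norm (w - v))\<^sup>2 \<le> (norm w)\<^sup>2 - (norm v)\<^sup>2"
  using assms by (simp add: power2_norm_eq_inner inner_simps inner_commute)

text \<open>A variational vector \<open>v\<close> has minimum norm by the Cauchy--Schwarz inequality, and any other
  minimum-norm \<open>w\<close> in the closure satisfies \<open>\<parallel>w - v\<parallel>\<^sup>2 \<le> \<parallel>w\<parallel>\<^sup>2 - \<parallel>v\<parallel>\<^sup>2 \<le> 0\<close>. So the description of
  the infimal displacement vector is meaningful, and picks out \<open>v\<close>.\<close>

theorem infimal_displacement_variational:
  fixes T :: "'a::{real_inner, complete_space} \<Rightarrow> 'a"
  assumes "nonexpansive T"
  shows "(norm (infimal_displacement_vector T))\<^sup>2 \<le> infimal_displacement_vector T \<bullet> (u - T u)"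
proof -
  let ?C = "closure (range (\<lambda>x. x - T x))"
  obtain v where v: "v \<in> ?C" and var: "\<And>u. (norm v)\<^sup>2 \<le> v \<bullet> (u - T u)"
    using displacement_variational_vector_exists[OF assms] by blast
  have varC: "(norm v)\<^sup>2 \<le> v \<bullet> w" if "w \<in> ?C" for w
  proof -
    have "closed {w. (norm v)\<^sup>2 \<le> v \<bullet> w}"
      by (intro closed_Collect_le continuous_intros)
    then have "?C \<subseteq> {w. (norm v)\<^sup>2 \<le> v \<bullet> w}"
      by (intro closure_minimal) (auto intro: var)
    then show ?thesis using that by blast
  qed
  have "infimal_displacement_vector T = v"
    unfolding infimal_displacement_vector_def
  proof (rule the_equality)
    show "v \<in> ?C \<and> (\<forall>w\<in>?C. norm v \<le> norm w)"
      using v by (blast intro: norm_ge_if_variational varC)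
  next
    fix w assume w: "w \<in> ?C \<and> (\<forall>w'\<in>?C. norm w \<le> norm w')"
    have "(norm (w - v))\<^sup>2 \<le> (norm w)\<^sup>2 - (norm v)\<^sup>2"
      using w by (intro norm_diff_le_if_variational varC) simp
    also have "\<dots> \<le> 0"
      using w v by (simp add: power_mono)
    finally show "w = v" by simp
  qed
  then show ?thesis using var by simp
qed

section \<open>Krasnosel'skii--Mann iterations\<close>

definition krasnoselskii_mann :: "('a::real_vector \<Rightarrow> 'a) \<Rightarrow> (nat \<Rightarrow> real) \<Rightarrow> (nat \<Rightarrow> 'a) \<Rightarrow> bool"
  where "krasnoselskii_mann T a x \<longleftrightarrow>
    (\<forall>k. x (Suc k) = a k *\<^sub>R x k + (1 - a k) *\<^sub>R T (x k))"

lemma krasnoselskii_mann_from_exists: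
  "\<exists>y. y 0 = z \<and> krasnoselskii_mann T a y"
proof -
  define y where "y = rec_nat z (\<lambda>k u. a k *\<^sub>R u + (1 - a k) *\<^sub>R T u)"
  have "y 0 = z \<and> krasnoselskii_mann T a y"
    by (simp add: krasnoselskii_mann_def y_def)
  then show ?thesis by blast
qed

text \<open>The new displacement is \<open>a\<close> times the old one plus \<open>T x - T x'\<close>, and the latter is at most as
  long as the step \<open>x - x'\<close>, which is \<open>1 - a\<close> times the old displacement.\<close>

lemma krasnoselskii_mann_displacement_antimono:
  fixes T :: "'a::real_normed_vector \<Rightarrow> 'a"
  assumes T: "nonexpansive T" and km: "krasnoselskii_mann T a x"
    and a: "\<And>k. 0 \<le> a k" "\<And>k. a k \<le> 1" and "i \<le> k"
  shows "norm (x k - T (x k)) \<le> norm (x i - T (x i))"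
proof -
  have "norm (x (Suc n) - T (x (Suc n))) \<le> norm (x n - T (x n))" for n
  proof -
    have eq: "x (Suc n) = a n *\<^sub>R x n + (1 - a n) *\<^sub>R T (x n)"
      using km by (simp add: krasnoselskii_mann_def)
    have step: "x n - x (Suc n) = (1 - a n) *\<^sub>R (x n - T (x n))"
      by (simp add: eq algebra_simps)
    have "x (Suc n) - T (x (Suc n)) = a n *\<^sub>R (x n - T (x n)) + (T (x n) - T (x (Suc n)))"
      by (subst (1) eq) (simp add: algebra_simps)
    then have "norm (x (Suc n) - T (x (Suc n)))
        \<le> norm (a n *\<^sub>R (x n - T (x n))) + norm (T (x n) - T (x (Suc n)))"
      by (metis norm_triangle_ineq)
    also have "\<dots> \<le> norm (a n *\<^sub>R (x n - T (x n))) + norm (x n - x (Suc n))"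
      using T by (simp add: nonexpansive_def)
    also have "\<dots> = norm (x n - T (x n))"
      unfolding step norm_scaleR using a[of n] by (simp add: left_diff_distrib)
    finally show ?thesis .
  qed
  then show ?thesis
    using \<open>i \<le> k\<close> by (rule lift_Suc_antimono_le)
qed

lemma norm_convex_combination:
  fixes p q :: "'a::real_inner"
  shows "(norm (t *\<^sub>R p + (1 - t) *\<^sub>R q))\<^sup>2
    = t * (norm p)\<^sup>2 + (1 - t) * (norm q)\<^sup>2 - t * (1 - t) * (norm (p - q))\<^sup>2"
  by (simp add: power2_norm_eq_inner inner_simps inner_commute algebra_simps)

text \<open>If the infimal displacement vector is not zero, \<open>T\<close> has no fixed point and the iterates drift
  away. Comparing them with a second iteration, which drifts in the same way, keeps the classical
  telescoping argument: by the identity for convex combinations, each step lowers the squared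
  distance by at least the summand.\<close>

lemma krasnoselskii_mann_pair_sum:
  fixes T :: "'a::real_inner \<Rightarrow> 'a"
  assumes T: "nonexpansive T"
    and x: "krasnoselskii_mann T a x" and y: "krasnoselskii_mann T a y"
    and a: "\<And>k. a k \<le> 1"
  shows "(\<Sum>i<n. a i * (1 - a i) * (norm ((x i - T (x i)) - (y i - T (y i))))\<^sup>2)
    \<le> (norm (x 0 - y 0))\<^sup>2"
proof -
  have step: "(norm (x (Suc i) - y (Suc i)))\<^sup>2
      + a i * (1 - a i) * (norm ((x i - T (x i)) - (y i - T (y i))))\<^sup>2
      \<le> (norm (x i - y i))\<^sup>2" for i
  proof -
    have "x (Suc i) - y (Suc i) = a i *\<^sub>R (x i - y i) + (1 - a i) *\<^sub>R (T (x i) - T (y i))"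
      using x y by (simp add: krasnoselskii_mann_def algebra_simps)
    moreover have "(x i - T (x i)) - (y i - T (y i)) = (x i - y i) - (T (x i) - T (y i))"
      by simp
    ultimately have "(norm (x (Suc i) - y (Suc i)))\<^sup>2
        + a i * (1 - a i) * (norm ((x i - T (x i)) - (y i - T (y i))))\<^sup>2
        = a i * (norm (x i - y i))\<^sup>2 + (1 - a i) * (norm (T (x i) - T (y i)))\<^sup>2"
      using norm_convex_combination[of "a i" "x i - y i" "T (x i) - T (y i)"]
      by (simp only: diff_add_cancel)
    also have "\<dots> \<le> a i * (norm (x i - y i))\<^sup>2 + (1 - a i) * (norm (x i - y i))\<^sup>2"
      using T a[of i] by (intro add_left_mono mult_left_mono power_mono)
        (auto simp: nonexpansive_def)
    finally show ?thesis by (simp add: algebra_simps)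
  qed
  have "(\<Sum>i<n. a i * (1 - a i) * (norm ((x i - T (x i)) - (y i - T (y i))))\<^sup>2)
      + (norm (x n - y n))\<^sup>2 \<le> (norm (x 0 - y 0))\<^sup>2"
  proof (induction n)
    case (Suc n)
    then show ?case using step[of n] by simp
  qed simp
  then show ?thesis
    using zero_le_power2[of "norm (x n - y n)"] by linarith
qed

section \<open>Rates of convergence\<close>

lemma weighted_mean_le_sqrt:
  fixes w d :: "'i \<Rightarrow> real"
  assumes w: "\<And>i. i \<in> I \<Longrightarrow> 0 \<le> w i" and pos: "0 < sum w I"
    and sq: "(\<Sum>i\<in>I. w i * (d i)\<^sup>2) \<le> B\<^sup>2" and B: "0 \<le> B"
  shows "(\<Sum>i\<in>I. w i / sum w I * d i) \<le> B / sqrt (sum w I)"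
proof -
  let ?S = "sum w I"
  have "(\<Sum>i\<in>I. w i * d i)\<^sup>2 = (\<Sum>i\<in>I. sqrt (w i) * (sqrt (w i) * d i))\<^sup>2"
    using w by (intro arg_cong[where f = "\<lambda>t. t\<^sup>2"] sum.cong) (auto simp flip: mult.assoc)
  also have "\<dots> \<le> (\<Sum>i\<in>I. (sqrt (w i))\<^sup>2) * (\<Sum>i\<in>I. (sqrt (w i) * d i)\<^sup>2)"
    by (rule Cauchy_Schwarz_ineq_sum)
  also have "\<dots> = ?S * (\<Sum>i\<in>I. w i * (d i)\<^sup>2)"
    using w by (intro arg_cong2[where f = "(*)"] sum.cong) (auto simp: power_mult_distrib)
  also have "\<dots> \<le> ?S * B\<^sup>2"
    using sq pos by (intro mult_left_mono) auto
  also have "\<dots> = (sqrt ?S * B)\<^sup>2"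
    using pos by (simp add: power_mult_distrib)
  finally have "(\<Sum>i\<in>I. w i * d i) \<le> sqrt ?S * B"
    by (rule power2_le_imp_le) (use pos B in simp)
  then have "(\<Sum>i\<in>I. w i * d i) / ?S \<le> sqrt ?S * B / ?S"
    using pos by (intro divide_right_mono) auto
  also have "sqrt ?S * B / ?S = B / sqrt ?S"
    using pos by (simp add: field_simps)
  finally show ?thesis by (simp add: sum_divide_distrib)
qed

text \<open>Both halves of the convergence result are instances: \<open>e\<^sup>2\<close> bounds how far the squared
  norm of the displacement at the comparison point \<open>z\<close> is from being minimal, and \<open>e = 0\<close> forces
  this displacement to be \<open>v\<close>.\<close>

theorem krasnoselskii_mann_rate:
  fixes T :: "'a::real_inner \<Rightarrow> 'a"
  assumes T: "nonexpansive T" and var: "\<And>u. (norm v)\<^sup>2 \<le> v \<bullet> (u - T u)"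
    and km: "krasnoselskii_mann T a x" and a: "\<And>k. 0 \<le> a k" "\<And>k. a k \<le> 1"
    and S: "S = (\<Sum>i=0..k. a i * (1 - a i))" "0 < S"
    and z: "(norm (z - T z))\<^sup>2 - (norm v)\<^sup>2 \<le> e\<^sup>2" and e: "0 \<le> e"
  shows "(\<Sum>i=0..k. a i * (1 - a i) / S * norm (x i - T (x i) - v)) \<le> norm (x 0 - z) / sqrt S + e"
      (is "?mean \<le> ?bound")
    and "norm (x k - T (x k)) - norm v \<le> norm (x 0 - z) / sqrt S + e"
    and "norm v \<le> norm (x k - T (x k))"
proof -
  define w where "w i = a i * (1 - a i)" for i
  have w: "0 \<le> w i" for i using a by (simp add: w_def)
  have S': "S = sum w {0..k}" using S by (simp add: w_def)
  have w1: "(\<Sum>i=0..k. w i / S) = 1"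
    using S S' by (simp flip: sum_divide_distrib)
  obtain y where y0: "y 0 = z" and y: "krasnoselskii_mann T a y"
    using krasnoselskii_mann_from_exists by blast
  have ye: "norm ((y i - T (y i)) - v) \<le> e" for i
  proof -
    have "(norm ((y i - T (y i)) - v))\<^sup>2 \<le> (norm (y i - T (y i)))\<^sup>2 - (norm v)\<^sup>2"
      by (rule norm_diff_le_if_variational[OF var])
    also have "\<dots> \<le> (norm (z - T z))\<^sup>2 - (norm v)\<^sup>2"
      using krasnoselskii_mann_displacement_antimono[OF T y a, of 0 i] y0 by (simp add: power_mono)
    also have "\<dots> \<le> e\<^sup>2" by (rule z)
    finally show ?thesis using e by (rule power2_le_imp_le)
  qed
  define d where "d i = norm ((x i - T (x i)) - (y i - T (y i)))" for i
  have "(\<Sum>i=0..k. w i * (d i)\<^sup>2) \<le> (norm (x 0 - z))\<^sup>2"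
    using krasnoselskii_mann_pair_sum[OF T km y a(2), of "Suc k"] y0
    by (simp add: w_def d_def lessThan_Suc_atMost atMost_atLeast0)
  then have mean_d: "(\<Sum>i=0..k. w i / S * d i) \<le> norm (x 0 - z) / sqrt S"
    unfolding S' using S S' w by (intro weighted_mean_le_sqrt) auto
  have "?mean = (\<Sum>i=0..k. w i / S * norm (x i - T (x i) - v))"
    by (simp add: w_def)
  also have "\<dots> \<le> (\<Sum>i=0..k. w i / S * (d i + e))"
  proof (intro sum_mono mult_left_mono)
    fix i
    have "x i - T (x i) - v = ((x i - T (x i)) - (y i - T (y i))) + ((y i - T (y i)) - v)"
      by simp
    then show "norm (x i - T (x i) - v) \<le> d i + e"
      unfolding d_def using norm_triangle_ineq ye by (metis add_left_mono order_trans)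
    show "0 \<le> w i / S" using w S by simp
  qed
  also have "\<dots> = (\<Sum>i=0..k. w i / S * d i) + (\<Sum>i=0..k. w i / S) * e"
    by (simp add: distrib_left sum.distrib sum_distrib_right)
  also have "\<dots> \<le> ?bound" using mean_d w1 by simp
  finally show mean: "?mean \<le> ?bound" .
  have "norm (x k - T (x k)) - norm v
      = (\<Sum>i=0..k. w i / S) * (norm (x k - T (x k)) - norm v)" by (simp only: w1 mult_1)
  also have "\<dots> \<le> (\<Sum>i=0..k. w i / S * norm (x i - T (x i) - v))"
    unfolding sum_distrib_right
  proof (intro sum_mono mult_left_mono)
    fix i assume "i \<in> {0..k}"
    then have "norm (x k - T (x k)) \<le> norm (x i - T (x i))"
      using krasnoselskii_mann_displacement_antimono[OF T km a] by simp
    then show "norm (x k - T (x k)) - norm v \<le> norm (x i - T (x i) - v)"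
      using norm_triangle_ineq2[of "x i - T (x i)" v] by linarith
    show "0 \<le> w i / S" using w S by simp
  qed
  also have "\<dots> = ?mean" by (simp add: w_def)
  also note mean
  finally show "norm (x k - T (x k)) - norm v \<le> ?bound" .
  show "norm v \<le> norm (x k - T (x k))"
    by (rule norm_ge_if_variational[OF var])
qed

text \<open>With \<open>d = \<parallel>w - v\<parallel>\<close> the left-hand side is at most \<open>2 d \<parallel>v\<parallel> + d\<^sup>2\<close>, and \<open>d \<le> 1\<close> bounds this by
  \<open>d (2 \<parallel>v\<parallel> + 1)\<close>; this explains the shape of the tolerance.\<close>

lemma norm_square_diff_le_if_close:
  fixes v w :: "'a::real_normed_vector"
  assumes "norm (w - v) \<le> e\<^sup>2 / (2 * norm v + 1)" "norm (w - v) \<le> 1"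
  shows "(norm w)\<^sup>2 - (norm v)\<^sup>2 \<le> e\<^sup>2"
proof -
  define d where "d = norm (w - v)"
  have "norm w \<le> norm v + d"
    unfolding d_def by (metis norm_triangle_sub)
  then have "(norm w)\<^sup>2 \<le> (norm v + d)\<^sup>2" by (intro power_mono) auto
  also have "\<dots> = (norm v)\<^sup>2 + d * (2 * norm v + d)"
    by (simp add: power2_eq_square algebra_simps)
  also have "\<dots> \<le> (norm v)\<^sup>2 + d * (2 * norm v + 1)"
    using assms by (intro add_left_mono mult_left_mono) (auto simp: d_def)
  also have "d * (2 * norm v + 1) \<le> e\<^sup>2"
  proof -
    have "0 < 2 * norm v + 1" using norm_ge_zero[of v] by linarith
    then show ?thesis using assms(1) by (simp add: pos_le_divide_eq d_def)
  qed
  finally show ?thesis by simp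
qed

theorem theorem4:
  fixes T :: "'a::{real_inner, complete_space} \<Rightarrow> 'a"
    and v :: 'a
    and lam :: "nat \<Rightarrow> real"
    and k\<^sub>0 :: nat
    and x :: "nat \<Rightarrow> 'a"
    and S :: "nat \<Rightarrow> real"
  assumes "nonexpansive T"
    and "v = infimal_displacement_vector T"
    and "\<forall>k\<ge>1. 0 \<le> lam k \<and> lam k < 1"
    and "\<exists>i\<ge>1. lam i > 0"
    and "k\<^sub>0 = (LEAST i. i \<ge> 1 \<and> lam i > 0)"
    and "\<forall>k. x (k + 1) = lam (k + 1) *\<^sub>R x k + (1 - lam (k + 1)) *\<^sub>R T (x k)"
    and "\<forall>k. S k = (\<Sum>j=0..k. lam (j + 1) * (1 - lam (j + 1)))"
  shows "(\<forall>\<epsilon>>0. \<forall>x\<^sub>\<epsilon>.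
            norm (x\<^sub>\<epsilon> - T x\<^sub>\<epsilon> - v) \<le> Min {\<epsilon>\<^sup>2 / (2 * norm v + 1), 1, \<epsilon>} \<longrightarrow>
            (\<forall>k\<ge>k\<^sub>0.
               (\<Sum>i=0..k. lam (i + 1) * (1 - lam (i + 1)) / S k * norm (x i - T (x i) - v))\<^sup>2
                 \<le> (1 / sqrt (S k) * norm (x 0 - x\<^sub>\<epsilon>) + \<epsilon>)\<^sup>2 \<and>
               (norm (x k - T (x k)) - norm v)\<^sup>2
                 \<le> (1 / sqrt (S k) * norm (x 0 - x\<^sub>\<epsilon>) + \<epsilon>)\<^sup>2)) \<and>
         (v \<in> range (\<lambda>y. y - T y) \<longrightarrow>
            (\<exists>x\<^sub>s. x\<^sub>s - T x\<^sub>s = v \<and>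
               (\<forall>k\<ge>k\<^sub>0.
                  (\<Sum>i=0..k. lam (i + 1) * (1 - lam (i + 1)) / S k * norm (x i - T (x i) - v))\<^sup>2
                    \<le> 1 / S k * (norm (x 0 - x\<^sub>s))\<^sup>2 \<and>
                  (norm (x k - T (x k)) - norm v)\<^sup>2
                    \<le> 1 / S k * (norm (x 0 - x\<^sub>s))\<^sup>2)))"
proof -
  define a where "a i = lam (i + 1)" for i
  have var: "(norm v)\<^sup>2 \<le> v \<bullet> (u - T u)" for u
    unfolding assms(2) by (rule infimal_displacement_variational[OF assms(1)])
  have a: "0 \<le> a i" "a i \<le> 1" "a i < 1" for i
    using assms(3) by (auto simp: a_def less_imp_le)
  have km: "krasnoselskii_mann T a x"
    using assms(6) by (simp add: krasnoselskii_mann_def a_def)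
  have S: "S k = (\<Sum>i=0..k. a i * (1 - a i))" for k
    using assms(7) by (simp add: a_def)
  have S_pos: "0 < S k" if "k\<^sub>0 \<le> k" for k
  proof -
    have k0: "k\<^sub>0 \<ge> 1" "lam k\<^sub>0 > 0"
      using LeastI_ex[OF assms(4)] unfolding assms(5) by auto
    \<comment> \<open>The weight of \<open>lam k\<^sub>0\<close> has index \<open>k\<^sub>0 - 1\<close> in the sum.\<close>
    show ?thesis
      unfolding S
    proof (rule sum_pos2[of _ "k\<^sub>0 - 1"])
      show "0 < a (k\<^sub>0 - 1) * (1 - a (k\<^sub>0 - 1))"
        using k0 a(3)[of "k\<^sub>0 - 1"] by (simp add: a_def)
    qed (use that a in auto)
  qed
  have rate: "(\<Sum>i=0..k. lam (i + 1) * (1 - lam (i + 1)) / S k * norm (x i - T (x i) - v))\<^sup>2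
                 \<le> (1 / sqrt (S k) * norm (x 0 - z) + e)\<^sup>2 \<and>
               (norm (x k - T (x k)) - norm v)\<^sup>2 \<le> (1 / sqrt (S k) * norm (x 0 - z) + e)\<^sup>2"
    if "k\<^sub>0 \<le> k" "(norm (z - T z))\<^sup>2 - (norm v)\<^sup>2 \<le> e\<^sup>2" "0 \<le> e" for k z e
  proof -
    note rates = krasnoselskii_mann_rate[OF assms(1) var km a(1,2) S S_pos[OF that(1)] that(2,3)]
    have "0 \<le> (\<Sum>i=0..k. lam (i + 1) * (1 - lam (i + 1)) / S k * norm (x i - T (x i) - v))"
      using S_pos[OF that(1)] a(1,2)
      by (intro sum_nonneg mult_nonneg_nonneg divide_nonneg_pos) (auto simp: a_def)
    then show ?thesis
      using rates by (intro conjI power_mono) (auto simp: a_def)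
  qed
  show ?thesis
  proof (intro conjI allI impI)
    fix e z k
    assume e: "0 < e" and z: "norm (z - T z - v) \<le> Min {e\<^sup>2 / (2 * norm v + 1), 1, e}"
      and k: "k\<^sub>0 \<le> k"
    have "(norm (z - T z))\<^sup>2 - (norm v)\<^sup>2 \<le> e\<^sup>2"
      using z by (intro norm_square_diff_le_if_close) auto
    note r = rate[OF k this less_imp_le[OF e]]
    show "(\<Sum>i=0..k. lam (i + 1) * (1 - lam (i + 1)) / S k * norm (x i - T (x i) - v))\<^sup>2
        \<le> (1 / sqrt (S k) * norm (x 0 - z) + e)\<^sup>2"
      using r by blast
    show "(norm (x k - T (x k)) - norm v)\<^sup>2 \<le> (1 / sqrt (S k) * norm (x 0 - z) + e)\<^sup>2"
      using r by blast
  next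
    assume "v \<in> range (\<lambda>y. y - T y)"
    then obtain z where z: "z - T z = v" by auto
    have sq: "(1 / sqrt (S k) * norm (x 0 - z) + 0)\<^sup>2 = 1 / S k * (norm (x 0 - z))\<^sup>2"
      if "k\<^sub>0 \<le> k" for k
      using S_pos[OF that] by (simp add: power_mult_distrib power_divide)
    show "\<exists>z. z - T z = v \<and>
               (\<forall>k\<ge>k\<^sub>0.
                  (\<Sum>i=0..k. lam (i + 1) * (1 - lam (i + 1)) / S k * norm (x i - T (x i) - v))\<^sup>2
                    \<le> 1 / S k * (norm (x 0 - z))\<^sup>2 \<and>
                  (norm (x k - T (x k)) - norm v)\<^sup>2
                    \<le> 1 / S k * (norm (x 0 - z))\<^sup>2)"
      using rate[of _ z 0, unfolded z] sq z by (intro exI[of _ z]) auto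
  qed
qed

end
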